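(* Let $H$ be a real Hilbert space, let $F:H\to H$ be monotone and continuous, and let $f_\delta\in H$. Let $a(t)=\frac{d}{(c+t)^b}$, $t\ge0$, where $d,c,b>0$ and $c\ge6b$. For $t\ge0$ let $V_\delta(t)\in H$ be the unique solution of $$F(V_\delta(t))+a(t)V_\delta(t)-f_\delta=0.$$ Then $$e^{-\frac t2}\int_0^te^{\frac s2}|\dot a(s)|\,\|V_\delta(s)\|\,ds\le\frac12a(t)\|V_\delta(t)\|,\qquad t\ge0.$$
   Context: Monotone means $\langle F(u)-F(v),u-v\rangle\ge0$ for all $u,v\in H$. It is known that for monotone continuous $F$ the equation $F(V)+aV-f_\delta=0$ has a unique solution for every $a>0$ and every $f_\delta\in H$. The dot denotes $d/dt$. Here $\delta$ and $f_\delta$ are fixed. *)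

theory Defs
  imports "HOL-Analysis.Analysis"
begin

definition monotone_operator :: "('a::real_inner \<Rightarrow> 'a) \<Rightarrow> bool" where
  "monotone_operator F \<longleftrightarrow> (\<forall>u v. (F u - F v) \<bullet> (u - v) \<ge> 0)"

definition reg_param :: "real \<Rightarrow> real \<Rightarrow> real \<Rightarrow> real \<Rightarrow> real" where
  "reg_param d c b t = d / (c + t) powr b"

end

theory Submission imports Defs begin

text \<open>Testing the equations for two parameters \<open>\<alpha> \<le> \<beta>\<close> against the difference of their
  solutions shows that \<open>\<parallel>V\<^sub>\<delta>\<parallel>\<close> is nondecreasing in time, so \<open>\<parallel>V\<^sub>\<delta>(s)\<parallel>\<close> may be replaced by
  \<open>\<parallel>V\<^sub>\<delta>(t)\<parallel>\<close> under the integral. Since \<open>\<bar>a'\<bar> = b a / (c + s)\<close>, the condition \<open>c \<ge> 6 b\<close> is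
  exactly what makes \<open>exp (s/2) \<bar>a'(s)\<bar>\<close> at most the derivative of \<open>exp (s/2) a(s) / 2\<close>.\<close>

text \<open>By Cauchy-Schwarz the nonnegative pairing \<open>(F u - F v) \<bullet> (u - v)\<close>
  is at most \<open>(norm v - norm u) * (\<alpha> * norm u - \<beta> * norm v)\<close>. If
  \<open>norm u < norm v\<close>, the first factor is positive and the second negative, a
  contradiction.\<close>

lemma regularized_solution_norm_antimono:
  fixes F :: "'h::real_inner \<Rightarrow> 'h"
  assumes mono: "monotone_operator F"
    and u: "F u + \<alpha> *\<^sub>R u = f" and v: "F v + \<beta> *\<^sub>R v = f"
    and "0 < \<alpha>" "\<alpha> \<le> \<beta>"
  shows "norm v \<le> norm u"
proof (rule ccontr)
  assume "\<not> norm v \<le> norm u"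
  then have lt: "norm u < norm v" by simp
  have Fdiff: "F u - F v = \<beta> *\<^sub>R v - \<alpha> *\<^sub>R u"
    using u v by (simp add: algebra_simps)
  have "0 \<le> (F u - F v) \<bullet> (u - v)"
    using mono by (simp add: monotone_operator_def)
  also have "\<dots> = (\<alpha> + \<beta>) * (u \<bullet> v) - \<alpha> * (norm u)\<^sup>2 - \<beta> * (norm v)\<^sup>2"
    unfolding Fdiff power2_norm_eq_inner
    by (simp add: inner_diff_left inner_diff_right inner_commute algebra_simps)
  also have "\<dots> \<le> (\<alpha> + \<beta>) * (norm u * norm v) - \<alpha> * (norm u)\<^sup>2 - \<beta> * (norm v)\<^sup>2"
    using assms by (simp add: mult_left_mono norm_cauchy_schwarz)
  also have "\<dots> = (norm v - norm u) * (\<alpha> * norm u - \<beta> * norm v)"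
    by (simp add: power2_eq_square algebra_simps)
  also have "\<dots> < 0"
  proof -
    have "\<alpha> * norm u < \<alpha> * norm v" using lt assms by simp
    also have "\<dots> \<le> \<beta> * norm v" using assms by (simp add: mult_right_mono)
    finally show ?thesis using lt by (simp add: mult_pos_neg)
  qed
  finally show False by simp
qed

lemma reg_param_has_real_derivative:
  assumes "c + s > 0"
  shows "(reg_param d c b has_real_derivative - (b * reg_param d c b s / (c + s))) (at s)"
proof -
  have eq: "reg_param d c b = (\<lambda>t. d * (c + t) powr (- b))"
    by (auto simp: reg_param_def powr_minus divide_inverse)
  show ?thesis
    unfolding eq using assms
    by (auto intro!: derivative_eq_intros simp: powr_diff field_simps)
qed

lemma reg_param_pos:
  assumes "d > 0" "c + s > 0"
  shows "reg_param d c b s > 0"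
  using assms by (simp add: reg_param_def)

lemma reg_param_antimono:
  assumes "d \<ge> 0" "b \<ge> 0" "c + s > 0" "s \<le> t"
  shows "reg_param d c b t \<le> reg_param d c b s"
  using assms by (auto simp: reg_param_def intro!: divide_left_mono powr_mono2 mult_pos_pos)

theorem lemma2p11:
  fixes F :: "'h::{real_inner, complete_space} \<Rightarrow> 'h"
    and f\<^sub>\<delta> :: 'h
    and V\<^sub>\<delta> :: "real \<Rightarrow> 'h"
    and a :: "real \<Rightarrow> real"
    and b c d t :: real
  assumes "monotone_operator F"
    and "continuous_on UNIV F"
    and "d > 0" and "c > 0" and "b > 0" and "c \<ge> 6 * b"
    and "a = reg_param d c b"
    and "\<And>s. s \<ge> 0 \<Longrightarrow> F (V\<^sub>\<delta> s) + a s *\<^sub>R V\<^sub>\<delta> s - f\<^sub>\<delta> = 0"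
    and "t \<ge> 0"
  shows "(\<lambda>s. exp (s / 2) * \<bar>deriv a s\<bar> * norm (V\<^sub>\<delta> s)) integrable_on {0..t} \<and>
    exp (- t / 2) * integral {0..t} (\<lambda>s. exp (s / 2) * \<bar>deriv a s\<bar> * norm (V\<^sub>\<delta> s))
      \<le> 1 / 2 * a t * norm (V\<^sub>\<delta> t)"
proof -
  have a_pos: "a s > 0" if "s \<ge> 0" for s
    using that assms by (simp add: reg_param_pos)
  \<comment> \<open>The derivative is two-sided even at 0, because \<open>c > 0\<close> keeps
    \<open>c + s\<close> positive to the left of 0; so \<open>deriv a\<close> has its closed form on
    all of \<open>{0..t}\<close>.\<close>
  have a_deriv: "(a has_real_derivative - (b * a s / (c + s))) (at s)" if "s \<ge> 0" for s
    using that assms by (simp add: reg_param_has_real_derivative)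
  have abs_deriv: "\<bar>deriv a s\<bar> = b * a s / (c + s)" if "s \<ge> 0" for s
    using DERIV_imp_deriv[OF a_deriv[OF that]] a_pos[OF that] that assms by simp
  \<comment> \<open>\<open>a\<close> decreases, so the later time \<open>s\<close> takes the role of
    the smaller parameter.\<close>
  have V_mono: "norm (V\<^sub>\<delta> r) \<le> norm (V\<^sub>\<delta> s)" if "0 \<le> r" "r \<le> s" for r s
  proof (rule regularized_solution_norm_antimono[OF assms(1)])
    show "F (V\<^sub>\<delta> s) + a s *\<^sub>R V\<^sub>\<delta> s = f\<^sub>\<delta>" "F (V\<^sub>\<delta> r) + a r *\<^sub>R V\<^sub>\<delta> r = f\<^sub>\<delta>"
      using that assms(8)[of s] assms(8)[of r] by simp_all
    show "0 < a s" using a_pos that by simp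
    show "a s \<le> a r" using that assms by (simp add: reg_param_antimono)
  qed
  define h where "h = (\<lambda>s. exp (s / 2) * \<bar>deriv a s\<bar>)"
  \<comment> \<open>The derivative of \<open>exp (s / 2) * a s / 2\<close>: the exponential
    contributes 1/4, and \<open>a' = - b * a / (c + s)\<close> the other term.\<close>
  define g' where "g' = (\<lambda>s. exp (s / 2) * a s * (1 / 4 - b / (c + s) / 2))"
  have h_nonneg: "0 \<le> h s" for s
    by (simp add: h_def)
  have "continuous_on {0..t} a"
    by (rule DERIV_continuous_on) (auto intro: DERIV_subset[OF a_deriv])
  then have "continuous_on {0..t} (\<lambda>s. exp (s / 2) * (b * a s / (c + s)))"
    using assms by (auto intro!: continuous_intros)
  then have "(\<lambda>s. exp (s / 2) * (b * a s / (c + s))) integrable_on {0..t}"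
    by (rule integrable_continuous_real)
  then have "h integrable_on {0..t}"
    by (rule integrable_eq) (simp add: h_def abs_deriv)
  \<comment> \<open>Only integrability is wanted here: the norm of the solution is monotone, which
    suffices without continuity in time. The value of the integral is discarded.\<close>
  then obtain x where "((\<lambda>s. norm (V\<^sub>\<delta> s) *\<^sub>R h s) has_integral
      (norm (V\<^sub>\<delta> 0) *\<^sub>R integral {0..x} h + norm (V\<^sub>\<delta> t) *\<^sub>R integral {x..t} h)) {0..t}"
    by (rule second_mean_value_theorem_full[where g = "\<lambda>s. norm (V\<^sub>\<delta> s)"])
      (use V_mono \<open>t \<ge> 0\<close> in auto)
  then have int: "(\<lambda>s. h s * norm (V\<^sub>\<delta> s)) integrable_on {0..t}"
    by (auto simp: integrable_on_def mult.commute)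
  have h_le: "h s \<le> g' s" if "s \<ge> 0" for s
  proof -
    \<comment> \<open>With \<open>r = b / (c + s)\<close> the claim amounts to
      \<open>r \<le> 1 / 4 - r / 2\<close>, that is \<open>r \<le> 1 / 6\<close>.\<close>
    have "b / (c + s) \<le> 1 / 6"
      using that assms by (simp add: field_simps)
    moreover have "r \<le> 1 / 4 - r / 2" if "r \<le> 1 / 6" for r :: real
      using that by simp
    ultimately have "b / (c + s) \<le> 1 / 4 - b / (c + s) / 2"
      by blast
    then have "exp (s / 2) * a s * (b / (c + s)) \<le> g' s"
      unfolding g'_def using a_pos[OF that] by (intro mult_left_mono) auto
    then show ?thesis using that by (simp add: h_def abs_deriv mult_ac)
  qed
  have "(g' has_integral (exp (t / 2) * a t / 2 - exp (0 / 2) * a 0 / 2)) {0..t}"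
  proof (rule fundamental_theorem_of_calculus[OF \<open>t \<ge> 0\<close>])
    fix s assume s: "s \<in> {0..t}"
    then have "((\<lambda>s. exp (s / 2) * a s / 2) has_real_derivative g' s) (at s)"
      using a_deriv[of s] assms(4)
      by (auto intro!: derivative_eq_intros simp: g'_def field_simps)
    then show "((\<lambda>s. exp (s / 2) * a s / 2) has_vector_derivative g' s) (at s within {0..t})"
      by (simp add: has_real_derivative_iff_has_vector_derivative has_vector_derivative_at_within)
  qed
  from has_integral_mult_left[OF this, of "norm (V\<^sub>\<delta> t)"]
  have "integral {0..t} (\<lambda>s. h s * norm (V\<^sub>\<delta> s))
      \<le> (exp (t / 2) * a t / 2 - exp (0 / 2) * a 0 / 2) * norm (V\<^sub>\<delta> t)"
  proof (rule has_integral_le[OF integrable_integral[OF int]])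
    show "h s * norm (V\<^sub>\<delta> s) \<le> g' s * norm (V\<^sub>\<delta> t)" if "s \<in> {0..t}" for s
      using that h_le[of s] h_nonneg[of s] V_mono[of s t] by (intro mult_mono) auto
  qed
  \<comment> \<open>The boundary term at 0 enters with a minus sign and is dropped, since
    \<open>a 0 > 0\<close>.\<close>
  also have "\<dots> \<le> exp (t / 2) * (a t / 2 * norm (V\<^sub>\<delta> t))"
    using a_pos[of 0] by (simp add: algebra_simps)
  finally have "exp (- t / 2) * integral {0..t} (\<lambda>s. h s * norm (V\<^sub>\<delta> s))
      \<le> exp (- t / 2) * (exp (t / 2) * (a t / 2 * norm (V\<^sub>\<delta> t)))"
    by (intro mult_left_mono) auto
  also have "\<dots> = 1 / 2 * a t * norm (V\<^sub>\<delta> t)"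
    by (simp add: exp_minus)
  finally show ?thesis
    using int unfolding h_def by blast
qed

end
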